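(* For every positive integer $n$, $$t(1,3,9;n)=t(1,3,27;3n+1)=\frac 12N(1,3,9;8n+13).$$
   Context: For positive integers $a_1,\dots,a_k$ and a nonnegative integer $n$, $N(a_1,\dots,a_k;n)$ is the number of $(x_1,\dots,x_k)\in\mathbb Z^k$ with $n=a_1x_1^2+\cdots+a_kx_k^2$, and $t(a_1,\dots,a_k;n)$ is the number of $(x_1,\dots,x_k)\in\mathbb Z^k$ with $n=a_1\frac{x_1(x_1-1)}2+\cdots+a_k\frac{x_k(x_k-1)}2$. *)

theory Defs
  imports Complex_Main
begin

text \<open>
  The coefficients \<open>a\<^sub>1, \<dots>, a\<^sub>k\<close> are the list \<open>as\<close>, and tuples in \<open>\<int>\<^sup>k\<close> are integer lists of
  the same length. For positive coefficients the counted sets are finite (proved below), so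
  \<^const>\<open>card\<close> is the true number of representations.
\<close>

definition num_sq_reps :: "nat list \<Rightarrow> nat \<Rightarrow> nat" where
  "num_sq_reps as n =
     card {xs :: int list. length xs = length as \<and>
       int n = (\<Sum>i<length as. int (as ! i) * (xs ! i)\<^sup>2)}"

text \<open>The \<open>div\<close> below is exact, since \<open>x (x - 1)\<close> is even.\<close>

definition num_tri_reps :: "nat list \<Rightarrow> nat \<Rightarrow> nat" where
  "num_tri_reps as n =
     card {xs :: int list. length xs = length as \<and>
       int n = (\<Sum>i<length as. int (as ! i) * (xs ! i * (xs ! i - 1) div 2))}"

lemma finite_reps_aux:
  fixes f :: "int \<Rightarrow> int"
  assumes pos: "\<forall>a\<in>set as. a > 0"
    and nonneg: "\<And>x. f x \<ge> 0"
    and bound: "\<And>x. \<bar>x\<bar> \<le> f x + 1"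
  shows "finite {xs. length xs = length as \<and> int n = (\<Sum>i<length as. int (as ! i) * f (xs ! i))}"
proof (rule finite_subset)
  show "finite {xs. set xs \<subseteq> {- int n - 1..int n + 1} \<and> length xs = length as}"
    by (rule finite_lists_length_eq) simp
  show "{xs. length xs = length as \<and> int n = (\<Sum>i<length as. int (as ! i) * f (xs ! i))}
    \<subseteq> {xs. set xs \<subseteq> {- int n - 1..int n + 1} \<and> length xs = length as}"
  proof (intro subsetI CollectI conjI; elim CollectE conjE)
    fix xs x
    assume len: "length xs = length as"
      and eq: "int n = (\<Sum>i<length as. int (as ! i) * f (xs ! i))"
      and "x \<in> set xs"
    then obtain i where i: "i < length as" "x = xs ! i"
      by (metis in_set_conv_nth)
    then have "as ! i > 0"
      using pos by simp
    then have "1 * f (xs ! i) \<le> int (as ! i) * f (xs ! i)"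
      by (intro mult_right_mono nonneg) simp
    also have "\<dots> \<le> (\<Sum>i<length as. int (as ! i) * f (xs ! i))"
      by (rule member_le_sum) (use i nonneg in auto)
    finally have "f x \<le> int n"
      using eq i by simp
    with bound[of x] show "x \<in> {- int n - 1..int n + 1}"
      by auto
  qed
qed

lemma finite_sq_reps:
  assumes "\<forall>a\<in>set as. a > 0"
  shows "finite {xs :: int list. length xs = length as \<and>
    int n = (\<Sum>i<length as. int (as ! i) * (xs ! i)\<^sup>2)}"
proof (rule finite_reps_aux[OF assms])
  fix x :: int
  have "0 \<le> (\<bar>x\<bar> - 1)\<^sup>2" "0 \<le> x\<^sup>2" by simp_all
  then show "\<bar>x\<bar> \<le> x\<^sup>2 + 1"
    by (simp add: power2_diff)
qed simp

lemma finite_tri_reps: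
  assumes "\<forall>a\<in>set as. a > 0"
  shows "finite {xs :: int list. length xs = length as \<and>
    int n = (\<Sum>i<length as. int (as ! i) * (xs ! i * (xs ! i - 1) div 2))}"
proof (rule finite_reps_aux[OF assms])
  fix x :: int
  have "0 \<le> x * (x - 1)"
    by (cases "x \<ge> 1") (auto intro: mult_nonneg_nonneg mult_nonpos_nonpos)
  then show "0 \<le> x * (x - 1) div 2"
    by simp
  have "0 \<le> (x - 1) * (x - 2)"
    by (cases "x \<ge> 2") (auto intro: mult_nonneg_nonneg mult_nonpos_nonpos)
  moreover have "0 \<le> x * (x + 1)"
    by (cases "x \<ge> 0") (auto intro: mult_nonneg_nonneg mult_nonpos_nonpos)
  ultimately have "2 * (\<bar>x\<bar> - 1) \<le> x * (x - 1)"
    by (auto simp: algebra_simps abs_if)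
  then have "2 * (\<bar>x\<bar> - 1) div 2 \<le> x * (x - 1) div 2"
    by (rule zdiv_mono1) simp
  then show "\<bar>x\<bar> \<le> x * (x - 1) div 2 + 1"
    by simp
qed

end

theory Submission
  imports Defs "HOL-Computational_Algebra.Primes"
begin

text \<open>
  Completing squares turns \<open>t(1,3,9;n)\<close> and \<open>t(1,3,27;3n+1)\<close> into counts of odd solutions of
  \<open>x\<^sup>2 + 3y\<^sup>2 + 9z\<^sup>2 = m\<close> and \<open>x\<^sup>2 + 3y\<^sup>2 + 27z\<^sup>2 = 3m\<close>, where \<open>m = 8n + 13\<close>; in the second equation
  \<open>3\<close> divides \<open>x\<close>, which gives the first equality. Since \<open>m \<equiv> 1 (mod 4)\<close>, a solution of
  \<open>x\<^sup>2 + 3y\<^sup>2 + 9z\<^sup>2 = m\<close> that is not all odd has exactly one odd entry, namely \<open>x\<close> or \<open>z\<close>.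
  The norm form satisfies \<open>(x - 3y)\<^sup>2 + 3(x + y)\<^sup>2 = 4(x\<^sup>2 + 3y\<^sup>2)\<close>, and every pair of odd integers is
  \<open>(x - 3y, \<plusminus>(x + y))\<close> for exactly one choice of the sign and of \<open>x, y\<close>, with \<open>x + y\<close> odd.
  Hence an even value \<open>k\<close> of the form that \<open>8\<close> does not divide is represented by twice as many odd
  as even pairs. Applied to \<open>x\<^sup>2 + 3y\<^sup>2\<close> and to \<open>y\<^sup>2 + 3z\<^sup>2\<close>, this makes each of the two remaining
  classes half as large as the all-odd class.
\<close>

abbreviation odds :: "int set" where "odds \<equiv> {x. odd x}"

abbreviation evens :: "int set" where "evens \<equiv> {x. even x}"

definition sq_triples :: "int \<Rightarrow> int \<Rightarrow> int \<Rightarrow> int \<Rightarrow> (int \<times> int \<times> int) set" where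
  "sq_triples a b c m = {(x, y, z). a * x\<^sup>2 + b * y\<^sup>2 + c * z\<^sup>2 = m}"

lemma mem_sq_triples [simp]:
  "(x, y, z) \<in> sq_triples a b c m \<longleftrightarrow> a * x\<^sup>2 + b * y\<^sup>2 + c * z\<^sup>2 = m"
  by (simp add: sq_triples_def)

subsection \<open>Representations as triples\<close>

lemma bij_betw_triples_lists_length_3:
  "bij_betw (\<lambda>(x, y, z). [x, y, z]) {(x, y, z). P [x, y, z]} {xs. length xs = 3 \<and> P xs}"
  by (rule bij_betw_byWitness[where f' = "\<lambda>xs. (xs ! 0, xs ! 1, xs ! 2)"])
    (auto simp: numeral_3_eq_3 numeral_2_eq_2 length_Suc_conv)

lemma bij_betw_sq_triples_lists:
  "bij_betw (\<lambda>(x, y, z). [x, y, z]) (sq_triples (int a) (int b) (int c) (int n))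
    {xs. length xs = length [a, b, c] \<and>
      int n = (\<Sum>i<length [a, b, c]. int ([a, b, c] ! i) * (xs ! i)\<^sup>2)}"
proof -
  let ?P = "\<lambda>xs. int n = (\<Sum>i<length [a, b, c]. int ([a, b, c] ! i) * (xs ! i)\<^sup>2)"
  have "sq_triples (int a) (int b) (int c) (int n) = {(x, y, z). ?P [x, y, z]}"
    by (auto simp: sq_triples_def numeral_2_eq_2)
  moreover have "length [a, b, c] = 3"
    by simp
  ultimately show ?thesis
    using bij_betw_triples_lists_length_3[of ?P] by (simp only:)
qed

lemma num_sq_reps_eq_card_sq_triples:
  "num_sq_reps [a, b, c] n = card (sq_triples (int a) (int b) (int c) (int n))"
  unfolding num_sq_reps_def by (rule bij_betw_same_card[OF bij_betw_sq_triples_lists, symmetric])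

lemma finite_sq_triples:
  assumes "a > 0" "b > 0" "c > 0"
  shows "finite (sq_triples (int a) (int b) (int c) (int n))"
  unfolding bij_betw_finite[OF bij_betw_sq_triples_lists]
  by (rule finite_sq_reps) (use assms in auto)

lemma square_eq_triangular: "(2 * x - 1)\<^sup>2 = 8 * (x * (x - 1) div 2) + (1 :: int)"
proof -
  have "8 * (x * (x - 1) div 2) = 4 * (2 * (x * (x - 1) div 2))"
    by simp
  also have "2 * (x * (x - 1) div 2) = x * (x - 1)"
    by (rule dvd_mult_div_cancel) simp
  finally show ?thesis
    by (simp add: power2_eq_square algebra_simps)
qed

lemma num_tri_reps_eq_card_odd_sq_reps:
  "num_tri_reps as n = card {xs. length xs = length as \<and> set xs \<subseteq> odds \<and>
    int (8 * n + sum_list as) = (\<Sum>i<length as. int (as ! i) * (xs ! i)\<^sup>2)}"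
    (is "_ = card ?O")
proof -
  let ?T = "{xs. length xs = length as \<and>
    int n = (\<Sum>i<length as. int (as ! i) * (xs ! i * (xs ! i - 1) div 2))}"
  let ?f = "map (\<lambda>x :: int. 2 * x - 1)" and ?g = "map (\<lambda>x :: int. (x + 1) div 2)"
  have sum_f: "(\<Sum>i<length as. int (as ! i) * (?f xs ! i)\<^sup>2) =
      8 * (\<Sum>i<length as. int (as ! i) * (xs ! i * (xs ! i - 1) div 2)) + int (sum_list as)"
    if "length xs = length as" for xs
    using that by (simp add: square_eq_triangular distrib_left mult.left_commute[of _ 8]
      sum.distrib sum_distrib_left sum_list_sum_nth atLeast0LessThan)
  have f_g: "?f (?g xs) = xs" if "set xs \<subseteq> odds" for xs
  proof -
    have "2 * ((x + 1) div 2) - 1 = x" if "x \<in> set xs" for x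
      using that \<open>set xs \<subseteq> odds\<close> by (auto elim!: oddE)
    then show ?thesis
      by (simp add: map_idI)
  qed
  have "bij_betw ?f ?T ?O"
  proof (rule bij_betw_byWitness[where f' = ?g])
    show "?f ` ?T \<subseteq> ?O"
      using sum_f by auto
    show "?g ` ?O \<subseteq> ?T"
    proof (rule image_subsetI)
      fix xs
      assume "xs \<in> ?O"
      then show "?g xs \<in> ?T"
        using sum_f[of "?g xs"] by (simp add: f_g del: nth_map map_map)
    qed
  qed (use f_g in \<open>auto simp: o_def\<close>)
  then show ?thesis
    unfolding num_tri_reps_def by (rule bij_betw_same_card)
qed

lemma num_tri_reps_eq_card_odd_sq_triples:
  "num_tri_reps [a, b, c] n =
    card (sq_triples (int a) (int b) (int c) (int (8 * n + a + b + c)) \<inter> odds \<times> odds \<times> odds)"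
proof -
  let ?P = "\<lambda>xs. set xs \<subseteq> odds \<and>
    int (8 * n + (a + b + c)) = (\<Sum>i<3. int ([a, b, c] ! i) * (xs ! i)\<^sup>2)"
  have "num_tri_reps [a, b, c] n = card {xs. length xs = 3 \<and> ?P xs}"
    unfolding num_tri_reps_eq_card_odd_sq_reps
    by (simp add: numeral_3_eq_3 numeral_2_eq_2 add.assoc)
  also have "\<dots> = card {(x, y, z). ?P [x, y, z]}"
    by (rule bij_betw_same_card[OF bij_betw_triples_lists_length_3, symmetric])
  also have "{(x, y, z). ?P [x, y, z]} =
    sq_triples (int a) (int b) (int c) (int (8 * n + a + b + c)) \<inter> odds \<times> odds \<times> odds"
    by (auto simp: sq_triples_def numeral_3_eq_3 numeral_2_eq_2)
  finally show ?thesis .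
qed

lemma card_sq_triples_rotate:
  "card (sq_triples a b c m \<inter> A \<times> B \<times> C) = card (sq_triples b c a m \<inter> B \<times> C \<times> A)"
proof (rule bij_betw_same_card)
  show "bij_betw (\<lambda>(x, y, z). (y, z, x))
    (sq_triples a b c m \<inter> A \<times> B \<times> C) (sq_triples b c a m \<inter> B \<times> C \<times> A)"
    by (rule bij_betw_byWitness[where f' = "\<lambda>(y, z, x). (x, y, z)"]) auto
qed

lemma sq_triples_scale_iff:
  assumes "p \<noteq> 0"
  shows "(p * y, x, z) \<in> sq_triples 1 (p * b) (p\<^sup>2 * c) (p * m) \<longleftrightarrow>
    (x, y, z) \<in> sq_triples b p (p * c) m"
proof -
  have "(p * y)\<^sup>2 + p * b * x\<^sup>2 + p\<^sup>2 * c * z\<^sup>2 = p * (b * x\<^sup>2 + p * y\<^sup>2 + p * c * z\<^sup>2)"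
    by (simp add: power2_eq_square algebra_simps)
  then show ?thesis
    using \<open>p \<noteq> 0\<close> by simp
qed

lemma prime_dvd_fst_sq_triple:
  assumes "prime p" "(x, y, z) \<in> sq_triples 1 (p * b) (p\<^sup>2 * c) (p * m)"
  shows "p dvd x"
proof (rule prime_dvd_power[OF \<open>prime p\<close>])
  have "x\<^sup>2 = p * (m - b * y\<^sup>2 - p * c * z\<^sup>2)"
    using assms(2) by (simp add: power2_eq_square algebra_simps)
  then show "p dvd x\<^sup>2"
    by simp
qed

lemma card_all_odd_sq_triples_scale_prime:
  assumes "prime p" "odd p"
  shows "card (sq_triples b p (p * c) m \<inter> odds \<times> odds \<times> odds) =
    card (sq_triples 1 (p * b) (p\<^sup>2 * c) (p * m) \<inter> odds \<times> odds \<times> odds)"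
    (is "card ?L = card ?R")
proof -
  let ?f = "\<lambda>(x, y, z). (p * y, x, z)"
  have "p \<noteq> 0"
    using \<open>prime p\<close> by auto
  have "bij_betw ?f ?L ?R"
  proof (rule bij_betw_imageI)
    show "inj_on ?f ?L"
      using \<open>p \<noteq> 0\<close> by (auto simp: inj_on_def)
    show "?f ` ?L = ?R"
    proof
      show "?f ` ?L \<subseteq> ?R"
        using \<open>odd p\<close> sq_triples_scale_iff[OF \<open>p \<noteq> 0\<close>] by (auto simp del: mem_sq_triples)
      show "?R \<subseteq> ?f ` ?L"
      proof clarify
        fix x y z
        assume sol: "(x, y, z) \<in> sq_triples 1 (p * b) (p\<^sup>2 * c) (p * m)"
          and odd: "odd x" "odd y" "odd z"
        obtain w where "x = p * w"
          using prime_dvd_fst_sq_triple[OF \<open>prime p\<close> sol] by (elim dvdE)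
        with sol odd sq_triples_scale_iff[OF \<open>p \<noteq> 0\<close>] show "(x, y, z) \<in> ?f ` ?L"
          by (intro image_eqI[where x = "(y, w, z)"]) (simp_all del: mem_sq_triples)
      qed
    qed
  qed
  then show ?thesis
    by (rule bij_betw_same_card)
qed

subsection \<open>Odd and even representations by the norm form\<close>

lemma norm_form_times_4:
  fixes x y s :: int
  assumes "s \<in> {1, - 1}"
  shows "(x - 3 * y)\<^sup>2 + 3 * (s * (x + y))\<^sup>2 = 4 * (x\<^sup>2 + 3 * y\<^sup>2)"
proof -
  have "s\<^sup>2 = 1"
    using assms by auto
  then have "(s * (x + y))\<^sup>2 = (x + y)\<^sup>2"
    by (simp only: power_mult_distrib mult_1)
  then show ?thesis
    by (simp add: power2_eq_square algebra_simps)
qed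

lemma sq_triples_norm_form_iff:
  assumes "s \<in> {1, - 1}"
  shows "(x - 3 * y, s * (x + y), z) \<in> sq_triples a (3 * a) c m \<longleftrightarrow>
    (x, y, z) \<in> sq_triples (4 * a) (12 * a) c m"
proof -
  have "a * (x - 3 * y)\<^sup>2 + 3 * a * (s * (x + y))\<^sup>2 =
      a * ((x - 3 * y)\<^sup>2 + 3 * (s * (x + y))\<^sup>2)"
    by (simp only: distrib_left mult.assoc mult.left_commute)
  also have "\<dots> = 4 * a * x\<^sup>2 + 12 * a * y\<^sup>2"
    unfolding norm_form_times_4[OF assms] by (simp add: algebra_simps)
  finally show ?thesis
    by simp
qed

lemma odd_pairE:
  fixes u v :: int
  assumes "odd u" "odd v"
  obtains x y s where "s \<in> {1, - 1}" "u = x - 3 * y" "v = s * (x + y)" "odd (x + y)"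
proof -
  have "4 dvd v - u \<or> 4 dvd - v - u"
    using assms by presburger
  then obtain s where s: "s \<in> {1, - 1}" "4 dvd s * v - u"
    by (metis insertI1 insertI2 mult_1 mult_minus1)
  then obtain y where "s * v - u = 4 * y"
    by (elim dvdE)
  with s assms show thesis
    by (intro that[of s "s * v - y" y]) auto
qed

lemma odd_pair_unique:
  fixes x y x' y' s s' :: int
  assumes "odd (x + y)" "s \<in> {1, - 1}" "s' \<in> {1, - 1}"
    and "x - 3 * y = x' - 3 * y'" "s * (x + y) = s' * (x' + y')"
  shows "x = x' \<and> y = y' \<and> s = s'"
proof -
  have "x + y \<noteq> - (x' + y')"
  proof
    assume "x + y = - (x' + y')"
    with assms(4) have "x + y = 2 * (y - y')"
      by simp
    with \<open>odd (x + y)\<close> show False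
      by simp
  qed
  with assms show ?thesis
    by auto
qed

lemma bij_betw_odd_odd_sq_triples:
  "bij_betw (\<lambda>((x, y, z), s). (x - 3 * y, s * (x + y), z))
    ((sq_triples (4 * a) (12 * a) c m \<inter> {(x, y, z). odd (x + y) \<and> z \<in> Z}) \<times> {1, - 1})
    (sq_triples a (3 * a) c m \<inter> odds \<times> odds \<times> Z)"
    (is "bij_betw ?f (?H \<times> {1, - 1}) ?O")
proof (rule bij_betw_imageI)
  show "inj_on ?f (?H \<times> {1, - 1})"
  proof (rule inj_onI)
    fix p q
    assume "p \<in> ?H \<times> {1, - 1}" "q \<in> ?H \<times> {1, - 1}" "?f p = ?f q"
    moreover obtain x y z s x' y' z' s' where "p = ((x, y, z), s)" "q = ((x', y', z'), s')"
      by (metis surj_pair)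
    ultimately show "p = q"
      using odd_pair_unique[of x y s s' x' y'] by simp
  qed
  show "?f ` (?H \<times> {1, - 1}) = ?O"
  proof
    show "?f ` (?H \<times> {1, - 1}) \<subseteq> ?O"
    proof clarify
      fix x y z s :: int
      assume "(x, y, z) \<in> sq_triples (4 * a) (12 * a) c m" "odd (x + y)" "z \<in> Z" "s \<in> {1, - 1}"
      then show "(x - 3 * y, s * (x + y), z) \<in> ?O"
        using sq_triples_norm_form_iff[of s x y z] by auto
    qed
    show "?O \<subseteq> ?f ` (?H \<times> {1, - 1})"
    proof clarify
      fix u v z
      assume sol: "(u, v, z) \<in> sq_triples a (3 * a) c m" and "odd u" "odd v" "z \<in> Z"
      obtain x y s where "s \<in> {1, - 1}" "u = x - 3 * y" "v = s * (x + y)" "odd (x + y)"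
        using \<open>odd u\<close> \<open>odd v\<close> by (rule odd_pairE)
      with sol \<open>z \<in> Z\<close> sq_triples_norm_form_iff[of s x y z]
      show "(u, v, z) \<in> ?f ` (?H \<times> {1, - 1})"
        by (intro image_eqI[where x = "((x, y, z), s)"]) simp_all
    qed
  qed
qed

lemma card_odd_odd_sq_triples_eq_twice:
  "card (sq_triples a (3 * a) c m \<inter> odds \<times> odds \<times> Z) =
    2 * card (sq_triples (4 * a) (12 * a) c m \<inter> {(x, y, z). odd (x + y) \<and> z \<in> Z})"
  using bij_betw_same_card[OF bij_betw_odd_odd_sq_triples[of a c m Z]]
  by (simp add: card_cartesian_product)

lemma eight_dvd_odd_square_minus_1:
  fixes x :: int
  assumes "odd x"
  shows "8 dvd x\<^sup>2 - 1"
proof -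
  have "x = 2 * ((x + 1) div 2) - 1"
    using assms by presburger
  then have "x\<^sup>2 - 1 = 8 * ((x + 1) div 2 * ((x + 1) div 2 - 1) div 2)"
    using square_eq_triangular[of "(x + 1) div 2"] by simp
  then show ?thesis
    by simp
qed

lemma odd_sum_if_sq_triple:
  assumes "\<not> 8 dvd m - c" "(x, y, z) \<in> sq_triples (4 * a) (12 * a) c m" "odd z"
  shows "odd (x + y)"
proof
  assume "even (x + y)"
  then have "even (x\<^sup>2 + 3 * y\<^sup>2)"
    by simp
  then obtain k where k: "x\<^sup>2 + 3 * y\<^sup>2 = 2 * k"
    by (elim evenE)
  have "m - c = 4 * a * (x\<^sup>2 + 3 * y\<^sup>2) + c * (z\<^sup>2 - 1)"
    using assms(2) by (simp add: algebra_simps)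
  also have "\<dots> = 8 * (a * k) + c * (z\<^sup>2 - 1)"
    unfolding k by simp
  finally have "8 dvd m - c"
    using eight_dvd_odd_square_minus_1[OF \<open>odd z\<close>] by (simp only: dvd_add dvd_mult dvd_triv_left)
  with assms(1) show False
    by contradiction
qed

lemma card_even_even_odd_sq_triples:
  assumes "\<not> 8 dvd m - c"
  shows "card (sq_triples a (3 * a) c m \<inter> evens \<times> evens \<times> odds) =
    card (sq_triples (4 * a) (12 * a) c m \<inter> {(x, y, z). odd (x + y) \<and> odd z})"
    (is "card ?E = card ?H")
proof -
  let ?f = "\<lambda>(x, y, z). (2 * x, 2 * y, z)"
  have "bij_betw ?f ?H ?E"
  proof (rule bij_betw_imageI)
    show "inj_on ?f ?H"
      by (auto simp: inj_on_def)
    show "?f ` ?H = ?E"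
    proof
      show "?f ` ?H \<subseteq> ?E"
        by auto
      show "?E \<subseteq> ?f ` ?H"
      proof clarify
        fix x y z
        assume sol: "(x, y, z) \<in> sq_triples a (3 * a) c m" and "even x" "even y" "odd z"
        then obtain x' y' where "x = 2 * x'" "y = 2 * y'"
          by (auto elim!: evenE)
        with sol \<open>odd z\<close> odd_sum_if_sq_triple[OF assms, of x' y' z a] show "(x, y, z) \<in> ?f ` ?H"
          by (intro image_eqI[where x = "(x', y', z)"]) (simp_all add: power_mult_distrib)
      qed
    qed
  qed
  then show ?thesis
    by (rule bij_betw_same_card[symmetric])
qed

lemma card_all_odd_eq_twice_card_even_even_odd:
  assumes "\<not> 8 dvd m - c"
  shows "card (sq_triples a (3 * a) c m \<inter> odds \<times> odds \<times> odds) =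
    2 * card (sq_triples a (3 * a) c m \<inter> evens \<times> evens \<times> odds)"
  using card_odd_odd_sq_triples_eq_twice[of a c m odds] card_even_even_odd_sq_triples[OF assms, of a]
  by simp

subsection \<open>The form with coefficients 1, 3, 9\<close>

lemma square_mod_4: "x\<^sup>2 mod 4 = of_bool (odd x)" for x :: int
proof (cases "even x")
  case True
  then show ?thesis
    by (auto elim!: evenE simp: power_mult_distrib)
next
  case False
  then have "8 dvd x\<^sup>2 - 1"
    by (rule eight_dvd_odd_square_minus_1)
  then have "x\<^sup>2 mod 4 = 1"
    by presburger
  with False show ?thesis
    by simp
qed

lemma parities_1_3_9:
  fixes x y z :: int
  assumes "(x\<^sup>2 + 3 * y\<^sup>2 + 9 * z\<^sup>2) mod 4 = 1"
  shows "odd x \<and> odd y \<and> odd z \<or> odd x \<and> even y \<and> even z \<or> even x \<and> even y \<and> odd z"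
proof -
  have "(of_bool (odd x) + 3 * of_bool (odd y) + 9 * of_bool (odd z) :: int) mod 4 = 1"
    using assms square_mod_4[of x] square_mod_4[of y] square_mod_4[of z] by presburger
  then show ?thesis
    by (cases "even x"; cases "even y"; cases "even z") simp_all
qed

lemma card_sq_triples_1_3_9_eq_twice_all_odd:
  fixes m :: nat
  assumes "m mod 8 = 5"
  shows "card (sq_triples 1 3 9 (int m)) =
    2 * card (sq_triples 1 3 9 (int m) \<inter> odds \<times> odds \<times> odds)"
proof -
  let ?S = "sq_triples 1 3 9 (int m)"
  let ?O = "?S \<inter> odds \<times> odds \<times> odds"
    and ?A = "?S \<inter> odds \<times> evens \<times> evens"
    and ?B = "?S \<inter> evens \<times> evens \<times> odds"
  have "int m mod 4 = 1" "\<not> 8 dvd int m - 9" "\<not> 8 dvd int m - 1"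
    using \<open>m mod 8 = 5\<close> by presburger+
  have "?S = ?O \<union> (?A \<union> ?B)"
  proof
    show "?S \<subseteq> ?O \<union> (?A \<union> ?B)"
    proof
      fix p
      assume "p \<in> ?S"
      moreover obtain x y z where "p = (x, y, z)"
        by (cases p)
      ultimately show "p \<in> ?O \<union> (?A \<union> ?B)"
        using \<open>int m mod 4 = 1\<close> parities_1_3_9[of x y z] by auto
    qed
  qed simp
  then have "card ?S = card (?O \<union> (?A \<union> ?B))"
    by (rule arg_cong)
  also have "\<dots> = card ?O + (card ?A + card ?B)"
    using finite_sq_triples[of 1 3 9 m] by (subst card_Un_disjoint; auto)+
  finally have "card ?S = card ?O + (card ?A + card ?B)" .
  moreover have "card ?O = 2 * card ?B"
    using card_all_odd_eq_twice_card_even_even_odd[OF \<open>\<not> 8 dvd int m - 9\<close>, of 1] by simp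
  moreover have "card ?O = 2 * card ?A"
    using card_all_odd_eq_twice_card_even_even_odd[OF \<open>\<not> 8 dvd int m - 1\<close>, of 3]
    by (simp add: card_sq_triples_rotate[of 1 3 9])
  ultimately show ?thesis
    by linarith
qed

theorem theorem2p4:
  fixes n :: nat
  assumes "n > 0"
  shows "num_tri_reps [1, 3, 9] n = num_tri_reps [1, 3, 27] (3 * n + 1) \<and>
    real (num_tri_reps [1, 3, 27] (3 * n + 1)) = 1 / 2 * real (num_sq_reps [1, 3, 9] (8 * n + 13))"
proof -
  let ?m = "8 * n + 13" and ?odd = "odds \<times> odds \<times> odds"
  have "num_tri_reps [1, 3, 9] n = card (sq_triples 1 3 9 (int ?m) \<inter> ?odd)"
    by (simp add: num_tri_reps_eq_card_odd_sq_triples add.commute)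
  moreover have "num_tri_reps [1, 3, 27] (3 * n + 1) =
      card (sq_triples 1 3 27 (3 * int ?m) \<inter> ?odd)"
    by (simp add: num_tri_reps_eq_card_odd_sq_triples add.commute)
  moreover have "card (sq_triples 1 3 9 (int ?m) \<inter> ?odd) =
      card (sq_triples 1 3 27 (3 * int ?m) \<inter> ?odd)"
    using card_all_odd_sq_triples_scale_prime[of 3 1 3 "int ?m"] by simp
  moreover have "num_sq_reps [1, 3, 9] ?m = 2 * card (sq_triples 1 3 9 (int ?m) \<inter> ?odd)"
  proof -
    have "?m mod 8 = 5"
      by presburger
    from card_sq_triples_1_3_9_eq_twice_all_odd[OF this] show ?thesis
      using num_sq_reps_eq_card_sq_triples[of 1 3 9 ?m]
      by simp
  qed
  ultimately show ?thesis
    by simp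
qed

end
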